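(* Let $\mathcal R_{\mathcal X}(u)=\sum_{k\ge2}g_ku^k$ be a rational distinguished restriction of a planar vector field $\mathcal X$ with nilpotent linearization at the origin, and let $d_{\mathcal X}$ be its recurrence degree. Then, beyond the finite inhomogeneous part determined by the numerator (i.e. for all sufficiently large indices), the Taylor coefficients $g_k$ satisfy a homogeneous linear recurrence with constant coefficients of order $d_{\mathcal X}$. Moreover, $d_{\mathcal X}$ is the smallest possible order of any eventual homogeneous linear recurrence with constant coefficients satisfied by the same Taylor coefficient sequence.
   Context: Setting: $\mathcal X$ is a $C^r$ ($r\ge2$) vector field near the origin of $\mathbb R^2$, $\mathcal X(0)=0$, and $A=D\mathcal X(0)$ satisfies $A\ne0$, $A^2=0$, so $\ker A=\operatorname{im}A$ is one-dimensional. For a generator $\mathbf e\neq 0$ of $\ker A$, the distinguished restriction is the unique scalar function near $0$ with $A\mathcal X(u\mathbf e)=\mathcal R_{\mathcal X}(u)\mathbf e$; it satisfies $\mathcal R_{\mathcal X}(0)=\mathcal R_{\mathcal X}'(0)=0$. It is rational if it coincides near $0$ with a real rational function. If it is rational and not identically zero, write $\mathcal R_{\mathcal X}(u)=u^2P(u)/Q(u)$ with $\gcd(P,Q)=1$, $Q(0)\ne0$; the recurrence degree is $d_{\mathcal X}:=\deg Q$. For the zero restriction $d_{\mathcal X}:=0$. With $c_n=g_{n+2}$ (and $c_j=0$ for $j<0$), an eventual homogeneous linear recurrence with constant coefficients of order $s\ge 0$ means: there are real constants $\widetilde q_0,\dots,\widetilde q_s$ with $\widetilde q_0\neq0$, $\widetilde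 q_s\neq0$ and an index $N$ such that $\widetilde q_0c_n+\widetilde q_1c_{n-1}+\cdots+\widetilde q_sc_{n-s}=0$ for all $n\ge N$. *)

theory Defs
  imports "HOL-Analysis.Analysis" "HOL-Computational_Algebra.Polynomial"
begin

text \<open>Class \<open>C\<^sup>r\<close> on an open set \<open>S\<close>: Frechet differentiable with all directional derivatives of class \<open>C\<^sup>r\<^sup>-\<^sup>1\<close>.\<close>

primrec C_class_on ::
  "nat \<Rightarrow> 'a::euclidean_space set \<Rightarrow> ('a \<Rightarrow> 'b::real_normed_vector) \<Rightarrow> bool" where
  "C_class_on 0 S f \<longleftrightarrow> continuous_on S f"
| "C_class_on (Suc r) S f \<longleftrightarrow>
     (\<forall>x\<in>S. f differentiable (at x)) \<and>
     (\<forall>v. C_class_on r S (\<lambda>x. frechet_derivative f (at x) v))"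

definition linearization :: "(real^2 \<Rightarrow> real^2) \<Rightarrow> real^2^2" where
  "linearization X = matrix (frechet_derivative X (at 0))"

definition nilpotent_planar_field :: "nat \<Rightarrow> (real^2 \<Rightarrow> real^2) \<Rightarrow> bool" where
  "nilpotent_planar_field r X \<longleftrightarrow>
     (\<exists>U. open U \<and> 0 \<in> U \<and> C_class_on r U X) \<and> X 0 = 0 \<and>
     linearization X \<noteq> 0 \<and> linearization X ** linearization X = 0"

text \<open>If \<open>e\<close> spans the kernel, which equals the image, of the linearization, then the scalar below
  exists and is unique for every \<open>u\<close>. Only its values for \<open>u\<close> near \<open>0\<close> matter.\<close>

definition distinguished_restriction :: "(real^2 \<Rightarrow> real^2) \<Rightarrow> real^2 \<Rightarrow> real \<Rightarrow> real" where
  "distinguished_restriction X e u =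
     (THE c. linearization X *v X (u *\<^sub>R e) = c *\<^sub>R e)"

text \<open>The punctured filter \<open>at 0\<close> lets \<open>p / q\<close> be an unreduced fraction with \<open>q(0) = 0\<close>, without relying
  on the value of a division by zero. A function continuous at \<open>0\<close>, such as a distinguished
  restriction, then also agrees at \<open>0\<close> with the reduced fraction.\<close>

definition rational_near_0 :: "(real \<Rightarrow> real) \<Rightarrow> bool" where
  "rational_near_0 R \<longleftrightarrow>
     (\<exists>p q :: real poly. q \<noteq> 0 \<and> (\<forall>\<^sub>F u in at 0. R u = poly p u / poly q u))"

definition recurrence_degree :: "(real \<Rightarrow> real) \<Rightarrow> nat" where
  "recurrence_degree R =
     (if \<forall>\<^sub>F u in nhds 0. R u = 0 then 0
      else (THE d. \<exists>P Q :: real poly. coprime P Q \<and> poly Q 0 \<noteq> 0 \<and>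
              (\<forall>\<^sub>F u in nhds 0. R u = u\<^sup>2 * poly P u / poly Q u) \<and> d = degree Q))"

definition taylor_coeff :: "(real \<Rightarrow> real) \<Rightarrow> nat \<Rightarrow> real" where
  "taylor_coeff R k = (deriv ^^ k) R 0 / fact k"

text \<open>The sequence \<open>c\<^sub>n = g\<^sub>n\<^sub>+\<^sub>2\<close> with \<open>c\<^sub>n = 0\<close> for \<open>n < 0\<close>; the index is an integer so that \<open>n - j\<close> is not
  truncated.\<close>

definition shifted_coeff :: "(nat \<Rightarrow> real) \<Rightarrow> int \<Rightarrow> real" where
  "shifted_coeff g n = (if n < 0 then 0 else g (nat n + 2))"

definition eventual_recurrence :: "(int \<Rightarrow> real) \<Rightarrow> nat \<Rightarrow> bool" where
  "eventual_recurrence c s \<longleftrightarrow>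
     (\<exists>q :: nat \<Rightarrow> real. q 0 \<noteq> 0 \<and> q s \<noteq> 0 \<and>
        (\<exists>N. \<forall>n\<ge>N. (\<Sum>j\<le>s. q j * c (n - int j)) = 0))"

end

theory Submission
  imports Defs "HOL-Computational_Algebra.Polynomial_Factorial"
    "HOL-Computational_Algebra.Field_as_Ring"
begin

text \<open>
  Since \<open>A\<^sup>2 = 0\<close>, the vector \<open>A X(u e)\<close> lies in \<open>ker A = span {e}\<close>, so the distinguished
  restriction \<open>R\<close> is a genuine scalar function, and it has a double zero at the origin: the
  chain rule gives \<open>R'(0) e = A A e = 0\<close>. Consequently a rational \<open>R\<close> is, in a full
  neighbourhood of \<open>0\<close>, of the form \<open>u\<^sup>2 P(u) / Q(u)\<close> with \<open>P\<close> and \<open>Q\<close> coprime and \<open>Q(0) \<noteq> 0\<close>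
  (lemma \<open>reduced_fraction_of_rational_near_0\<close>); \<open>Q\<close> is determined up to a unit, and its degree is
  the recurrence degree. The zero restriction fits the same form with \<open>P = 0\<close>, because coprimality
  then makes \<open>Q\<close> constant.

  As \<open>Q(0) \<noteq> 0\<close>, the fraction \<open>P / Q\<close> expands into a convergent power series \<open>C\<close>, whose
  coefficients are the shifted Taylor coefficients \<open>c\<^sub>n = g\<^sub>n\<^sub>+\<^sub>2\<close>.

  The rest is algebra of formal power series. The sum in a linear recurrence with coefficients \<open>q\<^sub>j\<close>
  is the \<open>n\<close>-th coefficient of \<open>T C\<close>, where \<open>T = \<Sum> q\<^sub>j x\<^sup>j\<close>. Hence eventual recurrences of order \<open>s\<close>
  correspond to polynomials \<open>T\<close> of degree \<open>s\<close> with \<open>T(0) \<noteq> 0\<close> for which \<open>T C\<close> is a polynomial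
  (lemma \<open>eventual_recurrence_shifted_coeff_iff\<close>). Because \<open>Q C = P\<close>, the denominator \<open>Q\<close> is such a
  multiplier. If \<open>T C = S\<close> is another one, then \<open>T P = Q S\<close>, and coprimality of \<open>P\<close> and \<open>Q\<close> forces
  \<open>Q\<close> to divide \<open>T\<close>, which gives minimality.
\<close>

unbundle no vec_syntax
unbundle fps_syntax

section \<open>Eventual recurrences as polynomial multipliers\<close>

text \<open>The convolution stops at the smaller of \<open>n\<close> and the degree of \<open>T\<close>. The convention that \<open>c\<close>
  vanishes at negative indices lets the sum always run up to the degree, which is the form that a
  recurrence has.\<close>

lemma nth_fps_of_poly_mult_shifted_coeff:
  fixes T :: "real poly"
  shows "(fps_of_poly T * Abs_fps (\<lambda>n. g (n + 2))) $ n
       = (\<Sum>j\<le>degree T. coeff T j * shifted_coeff g (int n - int j))"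
proof -
  have "(fps_of_poly T * Abs_fps (\<lambda>n. g (n + 2))) $ n
      = (\<Sum>j\<le>n. coeff T j * shifted_coeff g (int n - int j))"
    unfolding fps_mult_nth atLeast0AtMost
    by (intro sum.cong refl) (auto simp: shifted_coeff_def nat_diff_distrib)
  also have "\<dots> = (\<Sum>j\<le>max n (degree T). coeff T j * shifted_coeff g (int n - int j))"
    by (intro sum.mono_neutral_left) (auto simp: shifted_coeff_def)
  also have "\<dots> = (\<Sum>j\<le>degree T. coeff T j * shifted_coeff g (int n - int j))"
    by (intro sum.mono_neutral_right) (auto simp: coeff_eq_0)
  finally show ?thesis .
qed

lemma fps_eq_fps_of_poly_if_eventually_zero:
  fixes F :: "'a::zero fps"
  assumes "\<forall>n\<ge>N. F $ n = 0"
  shows "\<exists>S. F = fps_of_poly S"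
proof
  have "coeff (Abs_poly (fps_nth F)) = fps_nth F"
    using assms by (intro coeff_Abs_poly[of N]) auto
  then show "F = fps_of_poly (Abs_poly (fps_nth F))"
    by (simp add: fps_eq_iff)
qed

text \<open>The two nonvanishing conditions on the coefficients of a recurrence become conditions on the
  multiplier \<open>T\<close>: the first coefficient is \<open>T(0)\<close>, and the last one being nonzero says that the
  order is exactly the degree. The recurrence holds from the first index beyond the degree of
  \<open>S\<close>.\<close>

lemma eventual_recurrence_shifted_coeff_iff:
  "eventual_recurrence (shifted_coeff g) s \<longleftrightarrow>
     (\<exists>T S. poly T 0 \<noteq> 0 \<and> degree T = s \<and>
        fps_of_poly T * Abs_fps (\<lambda>n. g (n + 2)) = fps_of_poly S)"
proof
  assume "eventual_recurrence (shifted_coeff g) s"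
  then obtain q :: "nat \<Rightarrow> real" and N :: int where q: "q 0 \<noteq> 0" "q s \<noteq> 0"
    and rec: "\<And>n. n \<ge> N \<Longrightarrow> (\<Sum>j\<le>s. q j * shifted_coeff g (n - int j)) = 0"
    unfolding eventual_recurrence_def by blast
  define T where "T = Abs_poly (\<lambda>j. if j \<le> s then q j else 0)"
  have coeff_T: "coeff T j = (if j \<le> s then q j else 0)" for j
    unfolding T_def by (subst coeff_Abs_poly[of s]) auto
  have deg: "degree T = s"
    using q by (intro antisym degree_le le_degree) (auto simp: coeff_T)
  have "(fps_of_poly T * Abs_fps (\<lambda>n. g (n + 2))) $ n = 0" if "n \<ge> nat N" for n
    using rec[of "int n"] that
    by (simp add: nth_fps_of_poly_mult_shifted_coeff deg coeff_T nat_le_iff del: add_2_eq_Suc')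
  then obtain S where "fps_of_poly T * Abs_fps (\<lambda>n. g (n + 2)) = fps_of_poly S"
    using fps_eq_fps_of_poly_if_eventually_zero by blast
  then show "\<exists>T S. poly T 0 \<noteq> 0 \<and> degree T = s \<and>
      fps_of_poly T * Abs_fps (\<lambda>n. g (n + 2)) = fps_of_poly S"
    using q deg by (intro exI[of _ T] exI[of _ S]) (simp add: poly_0_coeff_0 coeff_T)
next
  assume "\<exists>T S. poly T 0 \<noteq> 0 \<and> degree T = s \<and>
      fps_of_poly T * Abs_fps (\<lambda>n. g (n + 2)) = fps_of_poly S"
  then obtain T S where T: "poly T 0 \<noteq> 0" "degree T = s"
    and S: "fps_of_poly T * Abs_fps (\<lambda>n. g (n + 2)) = fps_of_poly S"
    by blast
  have "(\<Sum>j\<le>s. coeff T j * shifted_coeff g (n - int j)) = 0"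
    if "n \<ge> int (Suc (degree S))" for n
    using nth_fps_of_poly_mult_shifted_coeff[of T g "nat n"] that T(2)
    by (simp add: S coeff_eq_0 del: add_2_eq_Suc')
  then show "eventual_recurrence (shifted_coeff g) s"
    unfolding eventual_recurrence_def using T
    by (intro exI[of _ "coeff T"] conjI exI[of _ "int (Suc (degree S))"])
       (auto simp: poly_0_coeff_0)
qed

text \<open>Two multipliers \<open>Q\<close> and \<open>T\<close> of the same series \<open>C\<close>, with products \<open>P\<close> and \<open>S\<close>, satisfy
  \<open>T P = T Q C = Q S\<close>. So \<open>Q\<close> divides \<open>T P\<close>, and a denominator in lowest terms divides every other
  multiplier.\<close>

lemma minimal_order_of_coprime_fraction:
  fixes P Q :: "real poly"
  assumes "coprime P Q" "poly Q 0 \<noteq> 0"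
    and PQ: "fps_of_poly Q * Abs_fps (\<lambda>n. g (n + 2)) = fps_of_poly P"
    and "eventual_recurrence (shifted_coeff g) s"
  shows "degree Q \<le> s"
proof -
  let ?C = "Abs_fps (\<lambda>n. g (n + 2))"
  obtain T S where T: "poly T 0 \<noteq> 0" "degree T = s"
    and S: "fps_of_poly T * ?C = fps_of_poly S"
    using assms(4) unfolding eventual_recurrence_shifted_coeff_iff by blast
  have "fps_of_poly (T * P) = fps_of_poly (Q * S)"
    by (simp only: fps_of_poly_mult PQ[symmetric] S[symmetric] mult.left_commute)
  then have "Q dvd T * P"
    by (simp add: fps_of_poly_eq_iff)
  then have "Q dvd T"
    using assms(1) by (simp add: coprime_commute coprime_dvd_mult_left_iff)
  then show ?thesis
    using T by (auto intro: dvd_imp_degree_le)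
qed

section \<open>Reduced fractions near the origin\<close>

lemma eventually_poly_nonzero_at:
  fixes q :: "real poly"
  assumes "q \<noteq> 0"
  shows "\<forall>\<^sub>F u in at a. poly q u \<noteq> 0"
proof -
  have "\<not> a islimpt {u. poly q u = 0}"
    using assms by (intro islimpt_finite poly_roots_finite)
  then show ?thesis
    by (simp add: islimpt_iff_eventually)
qed

lemma poly_eq_if_eventually_eq:
  fixes p q :: "real poly"
  assumes "\<forall>\<^sub>F u in at a. poly p u = poly q u"
  shows "p = q"
proof (rule ccontr)
  assume "p \<noteq> q"
  then have "\<forall>\<^sub>F u in at a. poly (p - q) u \<noteq> 0"
    by (intro eventually_poly_nonzero_at) simp
  with assms have "\<forall>\<^sub>F u in at a. False"
    by eventually_elim simp
  then show False by simp
qed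

lemma eventually_poly_nonzero_nhds:
  fixes Q :: "real poly"
  assumes "poly Q a \<noteq> 0"
  shows "\<forall>\<^sub>F u in nhds a. poly Q u \<noteq> 0"
proof -
  have "Q \<noteq> 0"
    using assms by auto
  with assms show ?thesis
    by (simp add: eventually_nhds_conv_at eventually_poly_nonzero_at)
qed

text \<open>Cancelling the greatest common divisor gives a reduced fraction \<open>p' / Q\<close> that agrees with \<open>R\<close>
  off the origin. By continuity the identity \<open>Q R = p'\<close> extends to \<open>0\<close>, so \<open>p'(0) = 0\<close>;
  coprimality then rules out a zero of \<open>Q\<close> there. Differentiating the same identity shows that
  the zero of \<open>p'\<close> is at least double, which splits off the factor \<open>u\<^sup>2\<close>.\<close>

lemma reduced_fraction_of_rational_near_0:
  assumes rat: "rational_near_0 R"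
    and R0: "R 0 = 0" and deriv: "(R has_field_derivative 0) (at 0)"
  obtains P Q :: "real poly" where "coprime P Q" "poly Q 0 \<noteq> 0"
    "\<forall>\<^sub>F u in nhds 0. R u = u\<^sup>2 * poly P u / poly Q u"
proof -
  obtain p q :: "real poly" where "q \<noteq> 0" and R: "\<forall>\<^sub>F u in at 0. R u = poly p u / poly q u"
    using rat unfolding rational_near_0_def by blast
  define p' where "p' = p div gcd p q"
  define Q where "Q = q div gcd p q"
  have cop: "coprime p' Q"
    unfolding p'_def Q_def using \<open>q \<noteq> 0\<close> by (intro div_gcd_coprime) simp
  have eqs: "p = p' * gcd p q" "q = Q * gcd p q"
    unfolding p'_def Q_def by simp_all
  have "gcd p q \<noteq> 0" "Q \<noteq> 0"
    using \<open>q \<noteq> 0\<close> eqs(2) by auto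
  have prod: "\<forall>\<^sub>F u in at 0. poly Q u * R u = poly p' u"
    using R eventually_poly_nonzero_at[OF \<open>gcd p q \<noteq> 0\<close>, of 0]
      eventually_poly_nonzero_at[OF \<open>Q \<noteq> 0\<close>, of 0]
  proof eventually_elim
    case (elim u)
    then show ?case
      by (subst (asm) (1) eqs(1), subst (asm) (1) eqs(2)) simp
  qed
  have cont: "isCont R 0"
    using deriv by (rule DERIV_isCont)
  have "((\<lambda>u. poly Q u * R u) \<longlongrightarrow> poly Q 0 * R 0) (at 0)"
    using cont by (intro tendsto_intros) (auto simp: isCont_def)
  then have "(poly p' \<longlongrightarrow> poly Q 0 * R 0) (at 0)"
    using prod by (rule Lim_transform_eventually)
  moreover have "(poly p' \<longlongrightarrow> poly p' 0) (at 0)"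
    by (intro tendsto_intros)
  ultimately have p0: "poly p' 0 = 0"
    using R0 tendsto_unique[of "at (0::real)"] by fastforce
  have Q0: "poly Q 0 \<noteq> 0"
    using cop p0 coprime_poly_0 by blast
  have prod_nhds: "\<forall>\<^sub>F u in nhds 0. poly Q u * R u = poly p' u"
    using prod p0 R0 by (simp add: eventually_nhds_conv_at)
  have "((\<lambda>u. poly Q u * R u) has_field_derivative 0) (at 0)"
    using DERIV_mult[OF poly_DERIV[of Q 0] deriv] by (simp add: R0)
  then have "(poly p' has_field_derivative 0) (at 0)"
    using prod_nhds by (subst (asm) DERIV_cong_ev[OF refl _ refl]) auto
  then have dp0: "poly (pderiv p') 0 = 0"
    using poly_DERIV DERIV_unique by blast
  define P where "P = poly_shift 2 p'"
  have p'_eq: "p' = [:0, 0, 1:] * P"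
  proof (rule poly_eqI)
    fix n
    have "coeff p' 0 = 0" "coeff p' (Suc 0) = 0"
      using p0 dp0 by (simp_all add: poly_0_coeff_0 coeff_pderiv)
    then show "coeff p' n = coeff ([:0, 0, 1:] * P) n"
      by (auto simp: P_def coeff_poly_shift coeff_pCons numeral_2_eq_2 split: nat.split)
  qed
  have "coprime P Q"
    using cop unfolding p'_eq by (simp only: coprime_mult_left_iff)
  moreover have "\<forall>\<^sub>F u in nhds 0. R u = u\<^sup>2 * poly P u / poly Q u"
    using prod_nhds eventually_poly_nonzero_nhds[OF Q0]
    by eventually_elim (simp add: p'_eq field_simps power2_eq_square)
  ultimately show thesis
    using that Q0 by blast
qed

text \<open>Two reduced fractions that agree near \<open>0\<close> satisfy \<open>P Q' = P' Q\<close>, whence each denominator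
  divides the other. If \<open>R\<close> vanishes near \<open>0\<close>, then \<open>P = 0\<close> and the coprime \<open>Q\<close> is a unit, in
  agreement with the convention that the recurrence degree is then \<open>0\<close>.\<close>

lemma recurrence_degree_eq_degree_denominator:
  fixes P Q :: "real poly"
  assumes cop: "coprime P Q" and Q0: "poly Q 0 \<noteq> 0"
    and R: "\<forall>\<^sub>F u in nhds 0. R u = u\<^sup>2 * poly P u / poly Q u"
  shows "recurrence_degree R = degree Q"
proof (cases "\<forall>\<^sub>F u in nhds 0. R u = 0")
  case True
  have "\<forall>\<^sub>F u in nhds 0. u \<noteq> 0 \<longrightarrow> poly P u = poly 0 u"
    using True R eventually_poly_nonzero_nhds[OF Q0] by eventually_elim auto
  then have "\<forall>\<^sub>F u in at 0. poly P u = poly 0 u"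
    by (simp add: eventually_at_filter)
  then have "P = 0"
    by (rule poly_eq_if_eventually_eq)
  then have "degree Q = 0"
    using cop Q0 is_unit_iff_degree[of Q] by (cases "Q = 0") auto
  with True show ?thesis
    by (simp add: recurrence_degree_def)
next
  case False
  have unique: "degree Q' = degree Q"
    if cop': "coprime P' Q'" and Q0': "poly Q' 0 \<noteq> 0"
      and R': "\<forall>\<^sub>F u in nhds 0. R u = u\<^sup>2 * poly P' u / poly Q' u" for P' Q' :: "real poly"
  proof -
    have "\<forall>\<^sub>F u in nhds 0. u \<noteq> 0 \<longrightarrow> poly (P * Q') u = poly (P' * Q) u"
      using R R' eventually_poly_nonzero_nhds[OF Q0] eventually_poly_nonzero_nhds[OF Q0']
      by eventually_elim (auto simp: field_simps)
    then have eq: "P * Q' = P' * Q"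
      by (intro poly_eq_if_eventually_eq[of _ _ 0]) (simp add: eventually_at_filter)
    have "Q dvd Q'" 
      using cop eq by (metis coprime_commute coprime_dvd_mult_right_iff dvd_triv_right)
    moreover have "Q' dvd Q"
      using cop' eq by (metis coprime_commute coprime_dvd_mult_right_iff dvd_triv_right)
    ultimately show ?thesis
      using Q0 Q0' by (intro antisym dvd_imp_degree_le) auto
  qed
  have "(THE d. \<exists>P Q :: real poly. coprime P Q \<and> poly Q 0 \<noteq> 0 \<and>
          (\<forall>\<^sub>F u in nhds 0. R u = u\<^sup>2 * poly P u / poly Q u) \<and> d = degree Q) = degree Q"
    using assms unique by (intro the_equality) blast+
  with False show ?thesis
    by (simp add: recurrence_degree_def)
qed

section \<open>Taylor coefficients\<close>

text \<open>Differentiating a power series term by term shows that \<open>deriv f\<close> is again the sum of its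
  formal derivative near \<open>0\<close>, so the coefficient of index \<open>n + 1\<close> of \<open>f\<close> reduces to that of index
  \<open>n\<close> of \<open>deriv f\<close>.\<close>

lemma taylor_coeff_eq_fps_nth:
  assumes "f has_fps_expansion F"
  shows "taylor_coeff f n = F $ n"
  using assms
proof (induction n arbitrary: f F)
  case 0
  then show ?case
    by (auto simp: taylor_coeff_def has_fps_expansion_def eval_fps_at_0 dest: eventually_nhds_x_imp_x)
next
  case (Suc n)
  \<comment> \<open>The innermost derivative is split off, since the induction hypothesis is applied to \<open>deriv f\<close>.\<close>
  have "taylor_coeff f (Suc n) = taylor_coeff (deriv f) n / real (Suc n)"
    unfolding taylor_coeff_def funpow_Suc_right by simp
  also have "\<dots> = fps_deriv F $ n / real (Suc n)"
    using Suc.IH[OF has_fps_expansion_deriv[OF Suc.prems]] by simp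
  finally show ?case
    by (simp del: of_nat_Suc)
qed

lemma has_fps_expansion_poly: "poly p has_fps_expansion fps_of_poly p"
  for p :: "real poly"
  by (simp add: has_fps_expansion_def)

lemma taylor_series_of_fraction:
  fixes P Q :: "real poly"
  assumes Q0: "poly Q 0 \<noteq> 0"
    and R: "\<forall>\<^sub>F u in nhds 0. R u = u\<^sup>2 * poly P u / poly Q u"
  shows "fps_of_poly Q * Abs_fps (\<lambda>n. taylor_coeff R (n + 2)) = fps_of_poly P"
    and "\<forall>\<^sub>F u in nhds 0. (\<lambda>k. taylor_coeff R (k + 2) * u ^ (k + 2)) sums R u"
proof -
  define C where "C = fps_of_poly P / fps_of_poly Q"
  have exp_PQ: "(\<lambda>u. poly P u / poly Q u) has_fps_expansion C"
    unfolding C_def using Q0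
    by (intro has_fps_expansion_divide' has_fps_expansion_poly) (simp add: poly_0_coeff_0)
  then have "(\<lambda>u. u ^ 2 * (poly P u / poly Q u)) has_fps_expansion fps_X ^ 2 * C"
    by (intro has_fps_expansion_mult has_fps_expansion_fps_X_power)
  then have "R has_fps_expansion fps_X ^ 2 * C"
    unfolding has_fps_expansion_def using R
    by (auto elim: eventually_elim2)
  then have coeff: "taylor_coeff R (n + 2) = C $ n" for n
    by (simp add: taylor_coeff_eq_fps_nth fps_X_power_mult_nth)
  have "fps_of_poly Q * C = fps_of_poly P"
    using Q0 unfolding C_def
    by (simp add: fps_divide_unit poly_0_coeff_0 mult.left_commute inverse_mult_eq_1')
  moreover have "Abs_fps (\<lambda>n. taylor_coeff R (n + 2)) = C"
    by (intro fps_ext) (simp add: coeff del: add_2_eq_Suc')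
  ultimately show "fps_of_poly Q * Abs_fps (\<lambda>n. taylor_coeff R (n + 2)) = fps_of_poly P"
    by simp
  have "\<forall>\<^sub>F u in nhds 0. u \<in> eball 0 (fps_conv_radius C)"
    using exp_PQ by (intro eventually_nhds_in_open) (auto simp: has_fps_expansion_def zero_ereal_def)
  moreover have "\<forall>\<^sub>F u in nhds 0. eval_fps C u = poly P u / poly Q u"
    using exp_PQ by (simp add: has_fps_expansion_def)
  ultimately show "\<forall>\<^sub>F u in nhds 0. (\<lambda>k. taylor_coeff R (k + 2) * u ^ (k + 2)) sums R u"
    using R
  proof eventually_elim
    case (elim u)
    then have "(\<lambda>k. C $ k * u ^ k) sums (poly P u / poly Q u)"
      using sums_eval_fps[of u C] by simp
    then have "(\<lambda>k. u\<^sup>2 * (C $ k * u ^ k)) sums (u\<^sup>2 * (poly P u / poly Q u))"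
      by (rule sums_mult)
    with elim show ?case
      by (simp add: coeff power_add mult_ac power2_eq_square del: add_2_eq_Suc')
  qed
qed

section \<open>The distinguished restriction of a nilpotent field\<close>

text \<open>An explicit formula replaces the definite description, so that continuity and
  differentiability can be read off. It is legitimate because \<open>A (A X(u e)) = 0\<close> puts \<open>A X(u e)\<close>
  on the line spanned by \<open>e\<close>, where the scalar is recovered by orthogonal projection.\<close>

lemma distinguished_restriction_eq_inner:
  assumes "e \<noteq> 0" and ker: "{v. linearization X *v v = 0} = span {e}"
    and sq: "linearization X ** linearization X = 0"
  shows "distinguished_restriction X e u
       = (linearization X *v X (u *\<^sub>R e)) \<bullet> e / (e \<bullet> e)"
proof -
  have "linearization X *v (linearization X *v X (u *\<^sub>R e)) = 0"
    by (simp add: matrix_vector_mul_assoc sq)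
  then obtain c where c: "linearization X *v X (u *\<^sub>R e) = c *\<^sub>R e"
    using ker by (auto simp: span_singleton)
  then have "distinguished_restriction X e u = c"
    unfolding distinguished_restriction_def using \<open>e \<noteq> 0\<close> by (intro the_equality) auto
  with c show ?thesis
    using \<open>e \<noteq> 0\<close> by simp
qed

text \<open>By the chain rule the derivative of \<open>A X(u e)\<close> at \<open>u = 0\<close> is \<open>A A e\<close>, which vanishes since \<open>e\<close>
  lies in the kernel of \<open>A\<close>.\<close>

lemma distinguished_restriction_flat:
  assumes "r \<ge> 1" and nil: "nilpotent_planar_field r X"
    and "e \<noteq> 0" and ker: "{v. linearization X *v v = 0} = span {e}"
  shows "distinguished_restriction X e 0 = 0"
    and "(distinguished_restriction X e has_field_derivative 0) (at 0)"
proof -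
  define A where "A = linearization X"
  have X0: "X 0 = 0" and sq: "A ** A = 0"
    using nil by (simp_all add: nilpotent_planar_field_def A_def)
  have R: "distinguished_restriction X e = (\<lambda>u. (A *v X (u *\<^sub>R e)) \<bullet> e / (e \<bullet> e))"
    using distinguished_restriction_eq_inner[OF \<open>e \<noteq> 0\<close> ker] sq by (simp add: fun_eq_iff A_def)
  show "distinguished_restriction X e 0 = 0"
    by (simp add: R X0)
  obtain U where "0 \<in> U" "C_class_on r U X"
    using nil unfolding nilpotent_planar_field_def by blast
  then have "X differentiable (at 0)"
    using \<open>r \<ge> 1\<close> by (cases r) auto
  then have "(X has_derivative (\<lambda>v. A *v v)) (at (0 *\<^sub>R e))"
    unfolding jacobian_works by (simp add: jacobian_def A_def linearization_def)
  then have DX: "((\<lambda>u. X (u *\<^sub>R e)) has_derivative (\<lambda>h. A *v (h *\<^sub>R e))) (at 0)"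
    by (rule has_derivative_compose[rotated]) (auto intro!: derivative_eq_intros)
  have "A *v e = 0"
    using ker span_base[of e "{e}"] by (auto simp: A_def)
  then have "(\<lambda>h. A *v (h *\<^sub>R e)) = (\<lambda>h. 0)"
    by (simp add: matrix_vector_mult_scaleR)
  with DX have "((\<lambda>u. X (u *\<^sub>R e)) has_derivative (\<lambda>h. 0)) (at 0)"
    by simp
  from bounded_linear.has_derivative[OF matrix_vector_mul_bounded_linear[of A] this]
  have "((\<lambda>u. A *v X (u *\<^sub>R e)) has_derivative (\<lambda>h. 0)) (at 0)"
    by simp
  then have "((\<lambda>u. (A *v X (u *\<^sub>R e)) \<bullet> e / (e \<bullet> e)) has_derivative (\<lambda>h. 0)) (at 0)"
    using \<open>e \<noteq> 0\<close> by (auto intro!: derivative_eq_intros)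
  then show "(distinguished_restriction X e has_field_derivative 0) (at 0)"
    by (simp add: R has_field_derivative_def lambda_zero)
qed

theorem proposition4p8:
  fixes X :: "real^2 \<Rightarrow> real^2" and e :: "real^2" and r :: nat
    and R :: "real \<Rightarrow> real" and g :: "nat \<Rightarrow> real"
  assumes "r \<ge> 2"
    and "nilpotent_planar_field r X"
    and "e \<noteq> 0" and "{v. linearization X *v v = 0} = span {e}"
    and "R = distinguished_restriction X e"
    and "rational_near_0 R"
    and "g = taylor_coeff R"
  shows "(\<forall>\<^sub>F u in nhds 0. (\<lambda>k. g (k + 2) * u ^ (k + 2)) sums R u) \<and>
         eventual_recurrence (shifted_coeff g) (recurrence_degree R) \<and>
         (\<forall>s. eventual_recurrence (shifted_coeff g) s \<longrightarrow> recurrence_degree R \<le> s)"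
proof -
  have "R 0 = 0" "(R has_field_derivative 0) (at 0)"
    using distinguished_restriction_flat[of r X e] assms(1-4) by (simp_all add: assms(5))
  with assms(6) obtain P Q :: "real poly" where PQ: "coprime P Q" "poly Q 0 \<noteq> 0"
    "\<forall>\<^sub>F u in nhds 0. R u = u\<^sup>2 * poly P u / poly Q u"
    using reduced_fraction_of_rational_near_0 by blast
  have mult: "fps_of_poly Q * Abs_fps (\<lambda>n. g (n + 2)) = fps_of_poly P"
    using taylor_series_of_fraction(1)[OF PQ(2,3)] by (simp add: assms(7))
  have deg: "recurrence_degree R = degree Q"
    by (rule recurrence_degree_eq_degree_denominator[OF PQ])
  have "\<forall>\<^sub>F u in nhds 0. (\<lambda>k. g (k + 2) * u ^ (k + 2)) sums R u"
    using taylor_series_of_fraction(2)[OF PQ(2,3)] by (simp only: assms(7))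
  moreover have "eventual_recurrence (shifted_coeff g) (recurrence_degree R)"
    unfolding eventual_recurrence_shifted_coeff_iff deg using PQ(2) mult by blast
  moreover have "recurrence_degree R \<le> s" if "eventual_recurrence (shifted_coeff g) s" for s
    unfolding deg by (rule minimal_order_of_coprime_fraction[OF PQ(1,2) mult that])
  ultimately show ?thesis
    by blast
qed

end
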